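(* Let $E$ be a Banach lattice, and let $T,S:E\to E$ be two operators. The following statements hold: (1) If $S$ is $\sigma$-weak-uo continuous, then $S$ is uo-demi Dunford–Pettis if and only if $S\circ T$ is uo-demi Dunford–Pettis. (2) If both $T$ and $S$ are $\sigma$-weak-uo continuous, then $T$ is uo-demi Dunford–Pettis if and only if $S\circ T$ is uo-demi Dunford–Pettis.
   Context: All Banach lattices are real; "operator" means bounded linear map. A net $(x_\alpha)$ in a Banach lattice $E$ is uo-convergent (unbounded order convergent) to $x$, written $x_\alpha\xrightarrow{uo}x$, if $|x_\alpha-x|\wedge y$ converges in order to $0$ for every $y\in E^+$. An operator $T:E\to E$ on a Banach lattice $E$ is uo-demi Dunford–Pettis (unbounded order demi Dunford–Pettis) if for every weakly null sequence $(x_n)$ in $E$ such that $(x_n-T(x_n))$ is uo-convergent to $0$, one has $\|x_n\|\to0$. An operator $T:E\to E$ is $\sigma$-weak-uo continuous if $T(x_n)\xrightarrow{uo}0$ in $E$ for every weakly null sequence $(x_n)$ in $E$. *)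

theory Defs
  imports
    "HOL-Analysis.Analysis"
    "HOL-Library.Lattice_Algebras"
    "HOL-Library.Lub_Glb"
begin

text \<open>
  The class \<^class>\<open>lattice_ab_group_add_abs\<close> fixes the modulus to be \<open>\<bar>x\<bar> = sup x (- x)\<close>.
\<close>

class banach_lattice = banach + ordered_real_vector + lattice_ab_group_add_abs +
  assumes norm_lattice_mono: "\<bar>x\<bar> \<le> \<bar>y\<bar> \<Longrightarrow> norm x \<le> norm y"

instance real :: banach_lattice
  by standard simp

text \<open>
  Nets are rendered as a function together with the filter of tails of its index set
  (\<^const>\<open>sequentially\<close> for sequences).  A net converges to \<open>l\<close> in order if there is a net
  \<open>(y\<^sub>\<gamma>)\<close>, possibly over a different index set, with \<open>y\<^sub>\<gamma> \<down> 0\<close> such that for each \<open>\<gamma>\<close>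
  eventually \<open>\<bar>x\<^sub>\<alpha> - l\<bar> \<le> y\<^sub>\<gamma>\<close>.  The range of a decreasing net is a nonempty downward directed
  set, and every such set is a decreasing net indexed by itself, so the dominating net is
  represented by its range \<open>D\<close>.
\<close>

definition decreases_to_zero :: "'a::banach_lattice set \<Rightarrow> bool" where
  "decreases_to_zero D \<longleftrightarrow>
     D \<noteq> {} \<and> (\<forall>a\<in>D. \<forall>b\<in>D. \<exists>c\<in>D. c \<le> a \<and> c \<le> b) \<and> isGlb UNIV D 0"

definition order_converges :: "('i \<Rightarrow> 'a::banach_lattice) \<Rightarrow> 'a \<Rightarrow> 'i filter \<Rightarrow> bool" where
  "order_converges x l F \<longleftrightarrow>
     (\<exists>D. decreases_to_zero D \<and> (\<forall>d\<in>D. \<forall>\<^sub>F \<alpha> in F. \<bar>x \<alpha> - l\<bar> \<le> d))"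

definition uo_converges :: "('i \<Rightarrow> 'a::banach_lattice) \<Rightarrow> 'a \<Rightarrow> 'i filter \<Rightarrow> bool" where
  "uo_converges x l F \<longleftrightarrow> (\<forall>y\<ge>0. order_converges (\<lambda>\<alpha>. inf \<bar>x \<alpha> - l\<bar> y) 0 F)"

definition weakly_null :: "(nat \<Rightarrow> 'a::real_normed_vector) \<Rightarrow> bool" where
  "weakly_null x \<longleftrightarrow> (\<forall>f::'a \<Rightarrow> real. bounded_linear f \<longrightarrow> (\<lambda>n. f (x n)) \<longlonglongrightarrow> 0)"

text \<open>
  Boundedness and linearity are not part of the next two predicates; they are to be applied to
  operators \<open>T\<close> with \<^prop>\<open>bounded_linear T\<close>.
\<close>

definition uo_demi_dunford_pettis :: "('a::banach_lattice \<Rightarrow> 'a) \<Rightarrow> bool" where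
  "uo_demi_dunford_pettis T \<longleftrightarrow>
     (\<forall>x. weakly_null x \<and> uo_converges (\<lambda>n. x n - T (x n)) 0 sequentially
        \<longrightarrow> (\<lambda>n. norm (x n)) \<longlonglongrightarrow> 0)"

definition sigma_weak_uo_continuous :: "('a::banach_lattice \<Rightarrow> 'a) \<Rightarrow> bool" where
  "sigma_weak_uo_continuous T \<longleftrightarrow>
     (\<forall>x. weakly_null x \<longrightarrow> uo_converges (\<lambda>n. T (x n)) 0 sequentially)"

end

theory Submission
  imports Defs
begin

text \<open>
  Perturbing by a uo-null sequence does not affect uo-convergence to \<open>0\<close>, so a
  \<open>\<sigma>\<close>-weak-uo continuous operator is uo-demi Dunford--Pettis if and only if every weakly null,
  uo-null sequence is norm null.  This condition does not mention the operator; and \<open>S \<circ> T\<close> is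
  \<open>\<sigma>\<close>-weak-uo continuous as soon as \<open>S\<close> is, because \<open>T\<close> preserves weakly null sequences.
\<close>

lemma isGlb_UNIV_0_iff:
  fixes D :: "'a::banach_lattice set"
  shows "isGlb UNIV D 0 \<longleftrightarrow> (\<forall>d\<in>D. 0 \<le> d) \<and> (\<forall>u. (\<forall>d\<in>D. u \<le> d) \<longrightarrow> u \<le> 0)"
  by (auto simp: isGlb_def isLb_def greatestP_def setge_def setle_def)

text \<open>This supplies the dominating net for a sum. Common lower elements are found in each
  summand separately, and the infimum is computed one variable at a time.\<close>

lemma decreases_to_zero_sums:
  fixes A B :: "'a::banach_lattice set"
  assumes A: "decreases_to_zero A" and B: "decreases_to_zero B"
  shows "decreases_to_zero {a + b |a b. a \<in> A \<and> b \<in> B}" (is "decreases_to_zero ?C")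
proof -
  have "?C \<noteq> {}"
    using A B by (auto simp: decreases_to_zero_def)
  moreover have "\<exists>c\<in>?C. c \<le> p \<and> c \<le> q" if "p \<in> ?C" "q \<in> ?C" for p q
  proof -
    from that obtain a b a' b' where p: "p = a + b" "a \<in> A" "b \<in> B"
      and q: "q = a' + b'" "a' \<in> A" "b' \<in> B" by blast
    obtain a'' where "a'' \<in> A" "a'' \<le> a" "a'' \<le> a'"
      using A p q by (meson decreases_to_zero_def)
    moreover obtain b'' where "b'' \<in> B" "b'' \<le> b" "b'' \<le> b'"
      using B p q by (meson decreases_to_zero_def)
    ultimately have "a'' + b'' \<in> ?C" "a'' + b'' \<le> p" "a'' + b'' \<le> q"
      using p q by (auto intro: add_mono)
    then show ?thesis by blast
  qed
  moreover have "u \<le> 0" if u: "\<forall>c\<in>?C. u \<le> c" for u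
  proof -
    \<comment> \<open>With \<open>a\<close> fixed and \<open>b\<close> ranging over
      \<open>B\<close>, \<open>u - a\<close> bounds \<open>B\<close> from below, and the infimum of
      \<open>B\<close> is \<open>0\<close>. Afterwards \<open>u\<close> itself bounds
      \<open>A\<close> from below.\<close>
    have "u - a \<le> 0" if "a \<in> A" for a
    proof -
      have "\<forall>b\<in>B. u - a \<le> b"
      proof
        fix b
        assume "b \<in> B"
        then have "u \<le> a + b" using u that by blast
        then show "u - a \<le> b" by (simp add: diff_le_eq add.commute)
      qed
      then show ?thesis
        using B unfolding decreases_to_zero_def isGlb_UNIV_0_iff by blast
    qed
    then have "\<forall>a\<in>A. u \<le> a"
      by simp
    then show ?thesis
      using A unfolding decreases_to_zero_def isGlb_UNIV_0_iff by blast
  qed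
  moreover have "\<forall>c\<in>?C. 0 \<le> c"
    using A B by (auto simp: decreases_to_zero_def isGlb_UNIV_0_iff)
  ultimately show ?thesis
    unfolding decreases_to_zero_def isGlb_UNIV_0_iff by blast
qed

text \<open>If \<open>A\<close> and \<open>B\<close> dominate \<open>x\<close> and \<open>y\<close>,
  the set of sums \<open>a + b\<close> dominates \<open>z\<close>: both eventual bounds hold
  together from some stage on.\<close>

lemma order_converges_0_dominated_add:
  fixes x y z :: "'i \<Rightarrow> 'a::banach_lattice"
  assumes "order_converges x 0 F" and "order_converges y 0 F"
    and le: "\<And>i. \<bar>z i\<bar> \<le> \<bar>x i\<bar> + \<bar>y i\<bar>"
  shows "order_converges z 0 F"
proof -
  obtain A B where A: "decreases_to_zero A" "\<And>a. a \<in> A \<Longrightarrow> \<forall>\<^sub>F i in F. \<bar>x i\<bar> \<le> a"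
    and B: "decreases_to_zero B" "\<And>b. b \<in> B \<Longrightarrow> \<forall>\<^sub>F i in F. \<bar>y i\<bar> \<le> b"
    using assms(1,2) unfolding order_converges_def diff_0_right by blast
  have "\<forall>\<^sub>F i in F. \<bar>z i\<bar> \<le> a + b" if "a \<in> A" "b \<in> B" for a b
    using A(2)[OF that(1)] B(2)[OF that(2)]
    by eventually_elim (meson add_mono le order_trans)
  then show ?thesis
    unfolding order_converges_def diff_0_right
    using decreases_to_zero_sums[OF A(1) B(1)] by blast
qed

text \<open>Since translations preserve infima, the right-hand side is the infimum of
  \<open>a + b\<close>, \<open>a + y\<close>, \<open>y + b\<close> and \<open>y + y\<close>. The
  first lies above \<open>inf (a + b) y\<close> trivially, the other three because they lie above
  \<open>y\<close>.\<close>

lemma inf_add_le_add_inf: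
  fixes a b y :: "'a::lattice_ab_group_add"
  assumes "0 \<le> a" "0 \<le> b" "0 \<le> y"
  shows "inf (a + b) y \<le> inf a y + inf b y"
proof -
  have "inf (a + b) y \<le> y + b" "inf (a + b) y \<le> a + y" "inf (a + b) y \<le> y + y"
    using assms by (auto intro: le_infI2 simp: add_increasing add_increasing2)
  then show ?thesis
    by (simp add: add_inf_distrib_left add_inf_distrib_right add.commute)
qed

text \<open>The triangle inequality and subadditivity of truncation at \<open>w\<close> reduce this
  to order convergence of the two truncated sequences.\<close>

lemma uo_converges_0_diff:
  fixes x y :: "'i \<Rightarrow> 'a::banach_lattice"
  assumes x: "uo_converges x 0 F" and y: "uo_converges y 0 F"
  shows "uo_converges (\<lambda>i. x i - y i) 0 F"
  unfolding uo_converges_def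
proof (intro allI impI)
  fix w :: 'a
  assume w: "0 \<le> w"
  have le: "inf \<bar>x i - y i\<bar> w \<le> inf (\<bar>x i\<bar>) w + inf (\<bar>y i\<bar>) w" for i
  proof -
    have "inf \<bar>x i - y i\<bar> w \<le> inf (\<bar>x i\<bar> + \<bar>y i\<bar>) w"
      by (intro inf_mono abs_triangle_ineq4 order_refl)
    also have "\<dots> \<le> inf (\<bar>x i\<bar>) w + inf (\<bar>y i\<bar>) w"
      using w by (intro inf_add_le_add_inf) auto
    finally show ?thesis .
  qed
  have "order_converges (\<lambda>i. inf (\<bar>x i\<bar>) w) 0 F" "order_converges (\<lambda>i. inf (\<bar>y i\<bar>) w) 0 F"
    using x y w by (simp_all add: uo_converges_def)
  then have "order_converges (\<lambda>i. inf \<bar>x i - y i\<bar> w) 0 F"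
    \<comment> \<open>All three truncations are nonnegative because \<open>w\<close> is, so the
      outer moduli in the domination condition disappear and \<open>le\<close> is exactly what
      remains.\<close>
    by (rule order_converges_0_dominated_add) (use w le in \<open>simp add: abs_of_nonneg\<close>)
  then show "order_converges (\<lambda>i. inf \<bar>x i - y i - 0\<bar> w) 0 F"
    by simp
qed

lemma uo_demi_dunford_pettis_iff_of_sigma_weak_uo_continuous:
  fixes U :: "'a::banach_lattice \<Rightarrow> 'a"
  assumes "sigma_weak_uo_continuous U"
  shows "uo_demi_dunford_pettis U \<longleftrightarrow>
    (\<forall>x::nat \<Rightarrow> 'a. weakly_null x \<and> uo_converges x 0 sequentially
        \<longrightarrow> (\<lambda>n. norm (x n)) \<longlonglongrightarrow> 0)"
proof -
  have "uo_converges (\<lambda>n. x n - U (x n)) 0 sequentially \<longleftrightarrow> uo_converges x 0 sequentially"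
    if "weakly_null x" for x
  proof -
    have U: "uo_converges (\<lambda>n. U (x n)) 0 sequentially"
      using assms that by (simp add: sigma_weak_uo_continuous_def)
    \<comment> \<open>The modulus ignores the sign. The negated sequence lets \<open>x n\<close> be
      recovered as the difference of \<open>x n - U (x n)\<close> and \<open>- U (x n)\<close>,
      which gives the forward direction.\<close>
    have "uo_converges (\<lambda>n. - U (x n)) 0 sequentially"
      using U by (simp add: uo_converges_def)
    then show ?thesis
      using uo_converges_0_diff[OF _ U, of x]
        uo_converges_0_diff[of "\<lambda>n. x n - U (x n)" sequentially "\<lambda>n. - U (x n)"]
      by auto
  qed
  then show ?thesis
    unfolding uo_demi_dunford_pettis_def by metis
qed

text \<open>A bounded functional \<open>f\<close> on the codomain pulls back along \<open>T\<close>
  to a bounded functional on the domain.\<close>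

lemma weakly_null_bounded_linear_image:
  fixes T :: "'a::real_normed_vector \<Rightarrow> 'b::real_normed_vector"
  assumes "bounded_linear T" and "weakly_null x"
  shows "weakly_null (\<lambda>n. T (x n))"
  unfolding weakly_null_def
proof (intro allI impI)
  fix f :: "'b \<Rightarrow> real"
  assume "bounded_linear f"
  then have "bounded_linear (\<lambda>y. f (T y))"
    using assms(1) by (rule bounded_linear_compose)
  then show "(\<lambda>n. f (T (x n))) \<longlonglongrightarrow> 0"
    using assms(2) unfolding weakly_null_def by blast
qed

lemma sigma_weak_uo_continuous_comp:
  assumes "sigma_weak_uo_continuous S" and "bounded_linear T"
  shows "sigma_weak_uo_continuous (S \<circ> T)"
  using assms weakly_null_bounded_linear_image[OF assms(2)]
  by (simp add: sigma_weak_uo_continuous_def)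

theorem proposition4p5:
  fixes T S :: "'a::banach_lattice \<Rightarrow> 'a"
  assumes "bounded_linear T" and "bounded_linear S"
  shows "(sigma_weak_uo_continuous S \<longrightarrow>
            (uo_demi_dunford_pettis S \<longleftrightarrow> uo_demi_dunford_pettis (S \<circ> T))) \<and>
         (sigma_weak_uo_continuous T \<and> sigma_weak_uo_continuous S \<longrightarrow>
            (uo_demi_dunford_pettis T \<longleftrightarrow> uo_demi_dunford_pettis (S \<circ> T)))"
  \<comment> \<open>In both parts the characterization rewrites each side of the equivalence to the
    same operator-free condition.\<close>
  using sigma_weak_uo_continuous_comp[OF _ assms(1), of S]
  by (simp add: uo_demi_dunford_pettis_iff_of_sigma_weak_uo_continuous)

end
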